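(* Let $X$ be a locally compact Hausdorff space. A family $\mathcal{F}\subset C_0(X)$ is relatively compact in the supremum-norm topology if and only if (i) $\mathcal{F}$ is pointwise bounded, i.e. for every $x\in X$ there exists $M_x>0$ such that $|f(x)|\leqslant M_x$ for all $f\in\mathcal{F}$; (ii) $\mathcal{F}$ is equicontinuous at every point, i.e. for every $x\in X$ and $\varepsilon>0$ there exists an open neighbourhood $U_x$ of $x$ such that $|f(y)-f(x)|\leqslant\varepsilon$ for all $y\in U_x$ and $f\in\mathcal{F}$; (iii) $\mathcal{F}$ is equivanishing, i.e. for every $\varepsilon>0$ there exists a compact set $K\subset X$ such that $|f(x)|\leqslant\varepsilon$ for all $x\in X\setminus K$ and $f\in\mathcal{F}$.
   Context: $C_0(X)$ is the space, with the supremum norm, of continuous functions $f:X\to\mathbb{C}$ vanishing at infinity, i.e. such that for every $\varepsilon>0$ there is a compact $K\subset X$ with $|f(x)|\leqslant\varepsilon$ for all $x\in X\setminus K$. Relatively compact means having compact closure. *)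

theory Defs
  imports "HOL-Analysis.Analysis"
begin

definition vanishes_at_infinity :: "'a topology \<Rightarrow> ('a \<Rightarrow> complex) \<Rightarrow> bool"
  where "vanishes_at_infinity X f \<longleftrightarrow>
    (\<forall>\<epsilon>>0. \<exists>K. compactin X K \<and> (\<forall>x \<in> topspace X - K. cmod (f x) \<le> \<epsilon>))"

text \<open>Functions are taken to be extensional, so that two of them are equal as soon as they
  agree on the carrier of \<open>X\<close>.\<close>

definition C0 :: "'a topology \<Rightarrow> ('a \<Rightarrow> complex) set"
  where "C0 X = {f \<in> extensional (topspace X). continuous_map X euclidean f \<and> vanishes_at_infinity X f}"

text \<open>The metric of the supremum norm, inherited from the bounded continuous functions; as every
  function in \<open>C0 X\<close> is bounded, its carrier is all of \<open>C0 X\<close> (lemma \<open>mspace_C0_metric\<close>).\<close>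

definition C0_metric :: "'a topology \<Rightarrow> ('a \<Rightarrow> complex) metric"
  where "C0_metric X = submetric (cfunspace X euclidean_metric) (C0 X)"

lemma C0_imp_bounded:
  assumes "f \<in> C0 X"
  shows "bounded (f ` topspace X)"
proof -
  have "vanishes_at_infinity X f" and cont: "continuous_map X euclidean f"
    using assms by (simp_all add: C0_def)
  from this(1) have "\<exists>K. compactin X K \<and> (\<forall>x \<in> topspace X - K. cmod (f x) \<le> 1)"
    unfolding vanishes_at_infinity_def by simp
  then obtain K where K: "compactin X K" "\<forall>x \<in> topspace X - K. cmod (f x) \<le> 1"
    by (elim exE conjE)
  have "compactin euclidean (f ` K)"
    by (rule image_compactin[OF K(1) cont])
  then have "bounded (f ` K)"
    by (simp add: compact_imp_bounded)
  moreover have "bounded (f ` (topspace X - K))"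
    using K(2) unfolding bounded_iff by blast
  ultimately have "bounded (f ` K \<union> f ` (topspace X - K))"
    by simp
  then show ?thesis
    by (rule bounded_subset) auto
qed

lemma C0_subset_cfunspace: "C0 X \<subseteq> mspace (cfunspace X euclidean_metric)"
proof
  fix f assume f: "f \<in> C0 X"
  have "Met_TC.mbounded (f ` topspace X)"
    unfolding Met_TC.mbounded using C0_imp_bounded[OF f]
    by (auto simp: bounded_def subset_iff)
  moreover have "f \<in> extensional (topspace X)" "continuous_map X euclidean f"
    using f by (simp_all add: C0_def)
  ultimately show "f \<in> mspace (cfunspace X euclidean_metric)"
    unfolding mspace_cfunspace mspace_euclidean_metric mdist_euclidean_metric mtopology_of_euclidean
    by simp
qed

lemma mspace_C0_metric: "mspace (C0_metric X) = C0 X"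
  unfolding C0_metric_def mspace_submetric using C0_subset_cfunspace by (rule Int_absorb2)

lemma mdist_C0_metric:
  assumes "f \<in> C0 X" "g \<in> C0 X" "topspace X \<noteq> {}"
  shows "mdist (C0_metric X) f g = (SUP x \<in> topspace X. cmod (f x - g x))"
proof -
  have fg: "f \<in> mspace (cfunspace X euclidean_metric)" "g \<in> mspace (cfunspace X euclidean_metric)"
    using assms(1,2)[THEN subsetD[OF C0_subset_cfunspace]] .
  have "f \<in> mspace (funspace (topspace X) euclidean_metric)"
    "g \<in> mspace (funspace (topspace X) euclidean_metric)"
    using fg cfunspace_subset_funspace by blast+
  then show ?thesis
    using assms(3)
    unfolding C0_metric_def mdist_submetric mdist_cfunspace_eq_mdist_funspace
      mdist_funspace mspace_funspace mspace_euclidean_metric mdist_euclidean_metric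
      Met_TC.fdist_def dist_norm
    by simp
qed

definition relatively_compact_in :: "'b topology \<Rightarrow> 'b set \<Rightarrow> bool"
  where "relatively_compact_in T S \<longleftrightarrow> S \<subseteq> topspace T \<and> compactin T (T closure_of S)"

definition pointwise_bounded :: "'a topology \<Rightarrow> ('a \<Rightarrow> complex) set \<Rightarrow> bool"
  where "pointwise_bounded X F \<longleftrightarrow>
    (\<forall>x \<in> topspace X. \<exists>M>0. \<forall>f \<in> F. cmod (f x) \<le> M)"

definition equicontinuous :: "'a topology \<Rightarrow> ('a \<Rightarrow> complex) set \<Rightarrow> bool"
  where "equicontinuous X F \<longleftrightarrow>
    (\<forall>x \<in> topspace X. \<forall>\<epsilon>>0. \<exists>U. openin X U \<and> x \<in> U \<and>
      (\<forall>y \<in> U. \<forall>f \<in> F. cmod (f y - f x) \<le> \<epsilon>))"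

definition equivanishing :: "'a topology \<Rightarrow> ('a \<Rightarrow> complex) set \<Rightarrow> bool"
  where "equivanishing X F \<longleftrightarrow>
    (\<forall>\<epsilon>>0. \<exists>K. compactin X K \<and> (\<forall>x \<in> topspace X - K. \<forall>f \<in> F. cmod (f x) \<le> \<epsilon>))"

end

theory Submission
  imports Defs
begin

text \<open>
  Since \<open>C0 X\<close> is complete, a family is relatively compact iff it is totally bounded, that is, iff
  for every \<open>\<epsilon>\<close> it lies within \<open>\<epsilon>\<close> (in supremum norm) of a finite subfamily
  (\<open>relatively_compact_in_C0_iff_finite_nets\<close>). The theorem thus becomes a statement about finite
  nets.

  A finite subset of \<open>C0 X\<close> satisfies each of the three conditions: take the maximum of finitely many
  bounds, the intersection of finitely many neighbourhoods, the union of finitely many compact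
  sets. The conditions pass to any family that is uniformly approximated by families
  satisfying them, so total boundedness implies all three. The same principle for equivanishing,
  applied to a single limit function, shows that \<open>C0 X\<close> is closed in the bounded continuous functions,
  which gives completeness.

  Conversely (\<open>finite_net_if_equicontinuous_equivanishing\<close>), equivanishing makes all members of the
  family small off one compact set \<open>K\<close>. Equicontinuity covers \<open>K\<close> by finitely many open sets
  on each of which every member is almost constant, so a member is determined up to a small error
  by its values at finitely many points. By pointwise boundedness these values form a bounded, hence
  totally bounded, set, and finitely many members suffice to approximate all of them.
\<close>

text \<open>Finiteness of \<open>G\<close> and \<open>G \<subseteq> F\<close> are stated separately, so that the same notion also expresses
  the approximation of a limit by the terms of a sequence.\<close>

definition uniform_net :: "'a topology \<Rightarrow> real \<Rightarrow> ('a \<Rightarrow> complex) set \<Rightarrow> ('a \<Rightarrow> complex) set \<Rightarrow> bool"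
  where "uniform_net X \<epsilon> G F \<longleftrightarrow> (\<forall>f\<in>F. \<exists>g\<in>G. \<forall>x\<in>topspace X. cmod (f x - g x) \<le> \<epsilon>)"

section \<open>Stability under uniform approximation\<close>

lemma pointwise_bounded_if_uniform_net:
  assumes "uniform_net X \<epsilon> G F" "pointwise_bounded X G"
  shows "pointwise_bounded X F"
  unfolding pointwise_bounded_def
proof
  fix x assume x: "x \<in> topspace X"
  then obtain M where M: "M > 0" "\<And>g. g \<in> G \<Longrightarrow> cmod (g x) \<le> M"
    using assms(2) unfolding pointwise_bounded_def by blast
  have "cmod (f x) \<le> M + \<bar>\<epsilon>\<bar>" if f: "f \<in> F" for f
  proof -
    obtain g where "g \<in> G" "cmod (f x - g x) \<le> \<epsilon>"
      using assms(1) f x unfolding uniform_net_def by blast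
    then show ?thesis
      using M(2)[of g] norm_triangle_sub[of "f x" "g x"] by linarith
  qed
  moreover have "M + \<bar>\<epsilon>\<bar> > 0" using M(1) by linarith
  ultimately show "\<exists>M>0. \<forall>f\<in>F. cmod (f x) \<le> M" by blast
qed

text \<open>The usual three-epsilon argument: go from \<open>f y\<close> to \<open>f x\<close> through \<open>g y\<close> and \<open>g x\<close>, with \<open>g\<close> close
  to \<open>f\<close>. The neighbourhood depends on the net only, so it serves all \<open>f\<close> at once.\<close>

lemma equicontinuous_if_uniform_nets:
  assumes "\<And>\<epsilon>. \<epsilon> > 0 \<Longrightarrow> \<exists>G. uniform_net X \<epsilon> G F \<and> equicontinuous X G"
  shows "equicontinuous X F"
  unfolding equicontinuous_def
proof (intro ballI allI impI)
  fix x and \<epsilon> :: real assume x: "x \<in> topspace X" and "\<epsilon> > 0"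
  then have e: "\<epsilon>/3 > 0" by simp
  obtain G where G: "uniform_net X (\<epsilon>/3) G F" "equicontinuous X G"
    using assms[OF e] by blast
  obtain U where U: "openin X U" "x \<in> U"
      "\<And>y g. y \<in> U \<Longrightarrow> g \<in> G \<Longrightarrow> cmod (g y - g x) \<le> \<epsilon>/3"
    using G(2) x e unfolding equicontinuous_def by metis
  have "cmod (f y - f x) \<le> \<epsilon>" if y: "y \<in> U" and f: "f \<in> F" for y f
  proof -
    obtain g where g: "g \<in> G" "\<And>z. z \<in> topspace X \<Longrightarrow> cmod (f z - g z) \<le> \<epsilon>/3"
      using G(1) f unfolding uniform_net_def by blast
    have "f y - f x = (f y - g y) + (g y - g x) + (g x - f x)" by simp
    then have "cmod (f y - f x) \<le> cmod (f y - g y) + cmod (g y - g x) + cmod (f x - g x)"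
      by (metis norm_minus_commute norm_triangle_le norm_triangle_ineq add_mono order_refl)
    moreover have "y \<in> topspace X"
      using U(1) y openin_subset by blast
    ultimately show ?thesis
      using g(2)[of y] g(2)[OF x] U(3)[OF y g(1)] by simp
  qed
  then show "\<exists>U. openin X U \<and> x \<in> U \<and> (\<forall>y\<in>U. \<forall>f\<in>F. cmod (f y - f x) \<le> \<epsilon>)"
    using U(1,2) by blast
qed

text \<open>Half of \<open>\<epsilon>\<close> bounds the net off its compact set, the other half pays for the approximation; the
  compact set depends on the net only.\<close>

lemma equivanishing_if_uniform_nets:
  assumes "\<And>\<epsilon>. \<epsilon> > 0 \<Longrightarrow> \<exists>G. uniform_net X \<epsilon> G F \<and> equivanishing X G"
  shows "equivanishing X F"
  unfolding equivanishing_def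
proof (intro allI impI)
  fix \<epsilon> :: real assume "\<epsilon> > 0"
  then have e: "\<epsilon>/2 > 0" by simp
  obtain G where G: "uniform_net X (\<epsilon>/2) G F" "equivanishing X G"
    using assms[OF e] by blast
  obtain K where K: "compactin X K"
      "\<And>x g. x \<in> topspace X - K \<Longrightarrow> g \<in> G \<Longrightarrow> cmod (g x) \<le> \<epsilon>/2"
    using G(2) e unfolding equivanishing_def by metis
  have "cmod (f x) \<le> \<epsilon>" if x: "x \<in> topspace X - K" and f: "f \<in> F" for x f
  proof -
    obtain g where g: "g \<in> G" "cmod (f x - g x) \<le> \<epsilon>/2"
      using G(1) f x unfolding uniform_net_def by blast
    then show ?thesis
      using K(2)[OF x g(1)] norm_triangle_sub[of "f x" "g x"] by linarith
  qed
  then show "\<exists>K. compactin X K \<and> (\<forall>x\<in>topspace X - K. \<forall>f\<in>F. cmod (f x) \<le> \<epsilon>)"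
    using K(1) by blast
qed

section \<open>Finite families\<close>

lemma pointwise_bounded_finite:
  assumes "finite G"
  shows "pointwise_bounded X G"
  unfolding pointwise_bounded_def
proof
  fix x
  have "bounded ((\<lambda>g. g x) ` G)"
    using assms by (simp add: finite_imp_bounded)
  then show "\<exists>M>0. \<forall>g\<in>G. cmod (g x) \<le> M"
    unfolding bounded_pos by blast
qed

lemma equicontinuous_finite:
  assumes "finite G" "\<And>g. g \<in> G \<Longrightarrow> continuous_map X euclidean g"
  shows "equicontinuous X G"
  unfolding equicontinuous_def
proof (intro ballI allI impI)
  fix x and \<epsilon> :: real assume x: "x \<in> topspace X" and e: "\<epsilon> > 0"
  \<comment> \<open>The intersection with the space keeps \<open>U\<close> from being \<open>UNIV\<close> when \<open>G\<close> is empty.\<close>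
  define V :: "('a \<Rightarrow> complex) \<Rightarrow> 'a set" where "V g = {y \<in> topspace X. g y \<in> ball (g x) \<epsilon>}" for g
  define U where "U = topspace X \<inter> \<Inter>(V ` G)"
  have "openin X (V g)" if "g \<in> G" for g
    unfolding V_def by (rule openin_continuous_map_preimage[OF assms(2)[OF that]]) simp
  then have "openin X U"
    unfolding U_def using assms(1) by (cases "G = {}") (auto intro!: openin_Inter openin_Int)
  moreover have "x \<in> U"
    unfolding U_def V_def using x e by simp
  moreover have "cmod (g y - g x) \<le> \<epsilon>" if "y \<in> U" "g \<in> G" for y g
    using that unfolding U_def V_def
    by (force simp: dist_norm norm_minus_commute)
  ultimately show "\<exists>U. openin X U \<and> x \<in> U \<and> (\<forall>y\<in>U. \<forall>g\<in>G. cmod (g y - g x) \<le> \<epsilon>)"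
    by blast
qed

lemma equivanishing_finite:
  assumes "finite G" "\<And>g. g \<in> G \<Longrightarrow> vanishes_at_infinity X g"
  shows "equivanishing X G"
  unfolding equivanishing_def
proof (intro allI impI)
  fix \<epsilon> :: real assume "\<epsilon> > 0"
  then have "\<forall>g\<in>G. \<exists>K. compactin X K \<and> (\<forall>x\<in>topspace X - K. cmod (g x) \<le> \<epsilon>)"
    using assms(2) unfolding vanishes_at_infinity_def by blast
  then obtain K where K: "\<And>g. g \<in> G \<Longrightarrow> compactin X (K g)"
      "\<And>g x. g \<in> G \<Longrightarrow> x \<in> topspace X - K g \<Longrightarrow> cmod (g x) \<le> \<epsilon>"
    by metis
  have "compactin X (\<Union>(K ` G))"
    using assms(1) K(1) by (intro compactin_Union) auto
  moreover have "cmod (g x) \<le> \<epsilon>" if "x \<in> topspace X - \<Union>(K ` G)" "g \<in> G" for x g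
    using that by (intro K(2)) auto
  ultimately show "\<exists>K. compactin X K \<and> (\<forall>x\<in>topspace X - K. \<forall>g\<in>G. cmod (g x) \<le> \<epsilon>)"
    by blast
qed

section \<open>Relative compactness and finite nets\<close>

text \<open>The hypothesis \<open>0 \<le> a\<close> covers the empty space, on which the distance is \<open>0\<close> and the
  pointwise condition is void.\<close>

lemma mdist_C0_metric_le:
  assumes "0 \<le> a" "\<And>x. x \<in> topspace X \<Longrightarrow> cmod (f x - g x) \<le> a"
  shows "mdist (C0_metric X) f g \<le> a"
  unfolding C0_metric_def mdist_submetric
  by (rule mdist_cfunspace_le) (use assms in \<open>auto simp: dist_norm\<close>)

lemma cmod_diff_le_mdist_cfunspace:
  assumes "f \<in> mspace (cfunspace X euclidean_metric)" "g \<in> mspace (cfunspace X euclidean_metric)"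
    "x \<in> topspace X"
  shows "cmod (f x - g x) \<le> mdist (cfunspace X euclidean_metric) f g"
  using mdist_cfunspace_imp_mdist_le[OF assms(1,2) order_refl assms(3)] by (simp add: dist_norm)

text \<open>A uniform limit of functions vanishing at infinity vanishes at infinity: this is stability of
  equivanishing under approximation, for a singleton family approximated by terms of the sequence.\<close>

lemma C0_sequentially_closed:
  assumes "range \<sigma> \<subseteq> C0 X" "limitin (mtopology_of (cfunspace X euclidean_metric)) \<sigma> f sequentially"
  shows "f \<in> C0 X"
proof -
  let ?m = "cfunspace X euclidean_metric :: ('a \<Rightarrow> complex) metric"
  interpret m: Metric_space "mspace ?m" "mdist ?m"
    by (rule Metric_space_mspace_mdist)
  have f: "f \<in> mspace ?m"
    and lim: "\<And>\<epsilon>. \<epsilon> > 0 \<Longrightarrow> \<exists>N. \<forall>n\<ge>N. \<sigma> n \<in> mspace ?m \<and> mdist ?m (\<sigma> n) f < \<epsilon>"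
    using assms(2) unfolding mtopology_of_def m.limit_metric_sequentially by auto
  have "\<exists>G. uniform_net X \<epsilon> G {f} \<and> equivanishing X G" if e: "\<epsilon> > 0" for \<epsilon>
  proof -
    obtain n where n: "\<sigma> n \<in> mspace ?m" "mdist ?m (\<sigma> n) f < \<epsilon>"
      using lim[OF e] by blast
    have "cmod (f x - \<sigma> n x) \<le> \<epsilon>" if "x \<in> topspace X" for x
      using cmod_diff_le_mdist_cfunspace[OF n(1) f that] n(2) by (simp add: norm_minus_commute)
    moreover have "equivanishing X {\<sigma> n}"
      using assms(1) by (intro equivanishing_finite) (auto simp: C0_def)
    ultimately show ?thesis
      unfolding uniform_net_def by blast
  qed
  then have "equivanishing X {f}"
    by (rule equivanishing_if_uniform_nets)
  then have "vanishes_at_infinity X f"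
    by (simp add: equivanishing_def vanishes_at_infinity_def)
  then show ?thesis
    using f by (simp add: C0_def)
qed

lemma mcomplete_C0: "Metric_space.mcomplete (C0 X) (mdist (C0_metric X))"
proof -
  let ?m = "cfunspace X euclidean_metric :: ('a \<Rightarrow> complex) metric"
  interpret Submetric "mspace ?m" "mdist ?m" "C0 X"
    by (rule Submetric.intro[OF Metric_space_mspace_mdist
        Submetric_axioms.intro[OF C0_subset_cfunspace]])
  have "mcomplete"
    using Met_TC.mcomplete_cfunspace[of X, where 'a=complex,
        unfolded Met_TC.Self_def, folded euclidean_metric_def]
    by (simp only: mcomplete_of_def mcomplete_iff_complete complete_UNIV)
  then show ?thesis
    unfolding C0_metric_def mdist_submetric
    using C0_sequentially_closed
    by (intro sequentially_closedin_mcomplete_imp_mcomplete) (auto simp: mtopology_of_def)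
qed

text \<open>Total boundedness uses open balls of the metric, uniform nets use non-strict pointwise
  inequalities; halving the radius in one direction absorbs the difference.\<close>

lemma relatively_compact_in_C0_iff_finite_nets:
  assumes "F \<subseteq> C0 X"
  shows "relatively_compact_in (mtopology_of (C0_metric X)) F \<longleftrightarrow>
    (\<forall>\<epsilon>>0. \<exists>G. finite G \<and> G \<subseteq> F \<and> uniform_net X \<epsilon> G F)"
proof -
  let ?d = "mdist (C0_metric X)"
  interpret Metric_space "C0 X" ?d
    using Metric_space_mspace_mdist[of "C0_metric X"] by (simp only: mspace_C0_metric)
  have top: "mtopology_of (C0_metric X) = mtopology"
    by (simp add: mtopology_of_def mspace_C0_metric)
  have "relatively_compact_in (mtopology_of (C0_metric X)) F \<longleftrightarrow> mtotally_bounded F"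
    unfolding relatively_compact_in_def top
    unfolding mtotally_bounded_eq_compact_closure_of[OF mcomplete_C0] topspace_mtopology ..
  also have "\<dots> \<longleftrightarrow> (\<forall>\<epsilon>>0. \<exists>G. finite G \<and> G \<subseteq> F \<and> uniform_net X \<epsilon> G F)"
  proof
    assume tb: "mtotally_bounded F"
    show "\<forall>\<epsilon>>0. \<exists>G. finite G \<and> G \<subseteq> F \<and> uniform_net X \<epsilon> G F"
    proof (intro allI impI)
      fix \<epsilon> :: real assume "\<epsilon> > 0"
      then obtain G where G: "finite G" "G \<subseteq> F" "F \<subseteq> (\<Union>g\<in>G. mball g \<epsilon>)"
        using tb[unfolded mtotally_bounded_def, rule_format, OF \<open>\<epsilon> > 0\<close>] by blast
      have "uniform_net X \<epsilon> G F"
        unfolding uniform_net_def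
      proof
        fix f assume f: "f \<in> F"
        then obtain g where g: "g \<in> G" "?d g f < \<epsilon>"
          using G(3) by auto
        have "f \<in> mspace (cfunspace X euclidean_metric)" "g \<in> mspace (cfunspace X euclidean_metric)"
          using f g(1) G(2) assms C0_subset_cfunspace by blast+
        then have "cmod (f x - g x) \<le> \<epsilon>" if "x \<in> topspace X" for x
          using cmod_diff_le_mdist_cfunspace[of g X f x] that g(2)
          by (simp add: C0_metric_def norm_minus_commute)
        then show "\<exists>g\<in>G. \<forall>x\<in>topspace X. cmod (f x - g x) \<le> \<epsilon>"
          using g(1) by blast
      qed
      then show "\<exists>G. finite G \<and> G \<subseteq> F \<and> uniform_net X \<epsilon> G F"
        using G by blast
    qed
  next
    assume nets: "\<forall>\<epsilon>>0. \<exists>G. finite G \<and> G \<subseteq> F \<and> uniform_net X \<epsilon> G F"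
    show "mtotally_bounded F"
      unfolding mtotally_bounded_def
    proof (intro allI impI)
      fix \<epsilon> :: real assume e: "\<epsilon> > 0"
      then have "\<epsilon>/2 > 0" by simp
      then obtain G where G: "finite G" "G \<subseteq> F" "uniform_net X (\<epsilon>/2) G F"
        using nets by blast
      have "f \<in> (\<Union>g\<in>G. mball g \<epsilon>)" if f: "f \<in> F" for f
      proof -
        obtain g where g: "g \<in> G" "\<And>x. x \<in> topspace X \<Longrightarrow> cmod (f x - g x) \<le> \<epsilon>/2"
          using G(3) f unfolding uniform_net_def by blast
        have "?d g f \<le> \<epsilon>/2"
          using e g(2) by (intro mdist_C0_metric_le) (auto simp: norm_minus_commute)
        then show ?thesis
          using e f g(1) G(2) assms by (intro UN_I[OF g(1)]) (auto simp: subset_iff)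
      qed
      then show "\<exists>K. finite K \<and> K \<subseteq> F \<and> F \<subseteq> (\<Union>x\<in>K. mball x \<epsilon>)"
        using G by blast
    qed
  qed
  finally show ?thesis .
qed

section \<open>Finite nets from the three conditions\<close>

text \<open>For each point of \<open>A\<close> the values of \<open>F\<close> are totally bounded in the plane, so they can be rounded to
  finitely many centres. Rounding at all points of \<open>A\<close> labels each function by one of finitely many
  maps, and functions with equal labels are close on \<open>A\<close>; one representative for each label that
  occurs gives a net inside \<open>F\<close>.\<close>

lemma finite_net_on_finite_set:
  fixes F :: "('a \<Rightarrow> complex) set"
  assumes "finite A" "\<And>a. a \<in> A \<Longrightarrow> bounded ((\<lambda>f. f a) ` F)" "\<epsilon> > 0"
  obtains G where "finite G" "G \<subseteq> F" "\<forall>f\<in>F. \<exists>g\<in>G. \<forall>a\<in>A. cmod (f a - g a) \<le> \<epsilon>"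
proof -
  have "\<exists>C. finite C \<and> (\<forall>f\<in>F. \<exists>c\<in>C. dist c (f a) < \<epsilon>/2)" if "a \<in> A" for a
  proof -
    have "compact (closure ((\<lambda>f. f a) ` F))"
      using assms(2)[OF that] by (simp add: compact_closure)
    then obtain C where "finite C" "closure ((\<lambda>f. f a) ` F) \<subseteq> (\<Union>c\<in>C. ball c (\<epsilon>/2))"
      using \<open>\<epsilon> > 0\<close> unfolding compact_eq_totally_bounded by (metis half_gt_zero)
    then show ?thesis
      using closure_subset[of "(\<lambda>f. f a) ` F"] by (intro exI[of _ C]) fastforce
  qed
  then obtain C where C: "\<And>a. a \<in> A \<Longrightarrow> finite (C a)"
      "\<And>a f. a \<in> A \<Longrightarrow> f \<in> F \<Longrightarrow> \<exists>c\<in>C a. dist c (f a) < \<epsilon>/2"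
    by metis
  define c where "c f a = (SOME c. c \<in> C a \<and> dist c (f a) < \<epsilon>/2)" for f a
  have c: "c f a \<in> C a" "dist (c f a) (f a) < \<epsilon>/2" if "a \<in> A" "f \<in> F" for a f
    using someI_ex[OF C(2)[OF that, unfolded Bex_def]] unfolding c_def by blast+
  define label where "label f = restrict (c f) A" for f
  have "label ` F \<subseteq> PiE A C"
    unfolding label_def using c(1) by auto
  then have "finite (label ` F)"
    using assms(1) C(1) by (meson finite_PiE finite_subset)
  then obtain G where G: "finite G" "G \<subseteq> F" "label ` F = label ` G"
    by (metis finite_subset_image order_refl)
  have "\<exists>g\<in>G. \<forall>a\<in>A. cmod (f a - g a) \<le> \<epsilon>" if f: "f \<in> F" for f
  proof -
    obtain g where g: "g \<in> G" "label f = label g"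
      using f G(3) by blast
    have "cmod (f a - g a) \<le> \<epsilon>" if a: "a \<in> A" for a
    proof -
      have "c f a = c g a"
        using fun_cong[OF g(2), of a] a by (simp add: label_def)
      moreover have "dist (c f a) (f a) < \<epsilon>/2" "dist (c g a) (g a) < \<epsilon>/2"
        using c(2)[OF a] f g(1) G(2) by blast+
      ultimately show ?thesis
        using dist_triangle3[of "f a" "g a" "c f a"] by (simp add: dist_norm)
    qed
    then show ?thesis using g(1) by blast
  qed
  then show thesis using that G(1,2) by blast
qed

text \<open>Two functions that nearly agree on the finite set \<open>A\<close> nearly agree everywhere: on \<open>K\<close> because both
  vary little between a point and an element of \<open>A\<close> whose neighbourhood contains it, off \<open>K\<close> because both are small.
  Three errors of \<open>\<epsilon>/3\<close> occur on \<open>K\<close> and two of \<open>\<epsilon>/2\<close> off it.\<close>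

lemma finite_net_if_equicontinuous_equivanishing:
  assumes "pointwise_bounded X F" "equicontinuous X F" "equivanishing X F" "\<epsilon> > 0"
  obtains G where "finite G" "G \<subseteq> F" "uniform_net X \<epsilon> G F"
proof -
  have e: "\<epsilon>/3 > 0" "\<epsilon>/2 > 0" using assms(4) by simp_all
  obtain K where K: "compactin X K"
      "\<And>x f. x \<in> topspace X - K \<Longrightarrow> f \<in> F \<Longrightarrow> cmod (f x) \<le> \<epsilon>/2"
    using assms(3) e(2) unfolding equivanishing_def by metis
  have KX: "K \<subseteq> topspace X"
    using K(1) compactin_subset_topspace by blast
  have "\<forall>x\<in>K. \<exists>U. openin X U \<and> x \<in> U \<and> (\<forall>y\<in>U. \<forall>f\<in>F. cmod (f y - f x) \<le> \<epsilon>/3)"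
    using assms(2)[unfolded equicontinuous_def, rule_format, OF _ e(1)] KX by blast
  then obtain U where "\<forall>x\<in>K. openin X (U x) \<and> x \<in> U x \<and>
      (\<forall>y\<in>U x. \<forall>f\<in>F. cmod (f y - f x) \<le> \<epsilon>/3)"
    by (rule bchoice[THEN exE])
  then have U: "\<And>x. x \<in> K \<Longrightarrow> openin X (U x)" "\<And>x. x \<in> K \<Longrightarrow> x \<in> U x"
      "\<And>x y f. x \<in> K \<Longrightarrow> y \<in> U x \<Longrightarrow> f \<in> F \<Longrightarrow> cmod (f y - f x) \<le> \<epsilon>/3"
    by blast+
  obtain \<V> where "finite \<V>" "\<V> \<subseteq> U ` K" "K \<subseteq> \<Union>\<V>"
    using compactinD[OF K(1), of "U ` K"] U(1,2) by blast
  then obtain A where A: "finite A" "A \<subseteq> K" "K \<subseteq> \<Union>(U ` A)"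
    by (metis finite_subset_image)
  have "bounded ((\<lambda>f. f a) ` F)" if "a \<in> A" for a
    using assms(1) A(2) KX that unfolding pointwise_bounded_def bounded_iff by blast
  then obtain G where G: "finite G" "G \<subseteq> F"
      "\<forall>f\<in>F. \<exists>g\<in>G. \<forall>a\<in>A. cmod (f a - g a) \<le> \<epsilon>/3"
    using finite_net_on_finite_set[OF A(1) _ e(1)] by blast
  have "uniform_net X \<epsilon> G F"
    unfolding uniform_net_def
  proof
    fix f assume f: "f \<in> F"
    then obtain g where g: "g \<in> G" "\<And>a. a \<in> A \<Longrightarrow> cmod (f a - g a) \<le> \<epsilon>/3"
      using G(3) by blast
    then have gF: "g \<in> F" using G(2) by blast
    have "cmod (f x - g x) \<le> \<epsilon>" if x: "x \<in> topspace X" for x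
    proof (cases "x \<in> K")
      case True
      then obtain a where a: "a \<in> A" "a \<in> K" "x \<in> U a"
        using A by blast
      have "f x - g x = (f x - f a) + (f a - g a) - (g x - g a)" by simp
      then have "cmod (f x - g x) \<le> cmod (f x - f a) + cmod (f a - g a) + cmod (g x - g a)"
        by (metis norm_triangle_ineq norm_triangle_ineq4 add_right_mono order_trans)
      then show ?thesis
        using U(3)[OF a(2,3) f] U(3)[OF a(2,3) gF] g(2)[OF a(1)] by simp
    next
      case False
      then show ?thesis
        using K(2)[of x f] K(2)[of x g] f gF x norm_triangle_ineq4[of "f x" "g x"] by simp
    qed
    then show "\<exists>g\<in>G. \<forall>x\<in>topspace X. cmod (f x - g x) \<le> \<epsilon>"
      using g(1) by blast
  qed
  then show thesis using that G(1,2) by blast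
qed

theorem theorem5:
  fixes X :: "'a topology" and F :: "('a \<Rightarrow> complex) set"
  assumes "locally_compact_space X" and "Hausdorff_space X" and "F \<subseteq> C0 X"
  shows "relatively_compact_in (mtopology_of (C0_metric X)) F \<longleftrightarrow>
    pointwise_bounded X F \<and> equicontinuous X F \<and> equivanishing X F"
  unfolding relatively_compact_in_C0_iff_finite_nets[OF assms(3)]
proof
  assume nets: "\<forall>\<epsilon>>0. \<exists>G. finite G \<and> G \<subseteq> F \<and> uniform_net X \<epsilon> G F"
  have "\<exists>G. uniform_net X \<epsilon> G F \<and> pointwise_bounded X G \<and> equicontinuous X G \<and> equivanishing X G"
    if "\<epsilon> > 0" for \<epsilon>
  proof -
    obtain G where G: "finite G" "G \<subseteq> F" "uniform_net X \<epsilon> G F"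
      using nets \<open>\<epsilon> > 0\<close> by blast
    have "continuous_map X euclidean g" "vanishes_at_infinity X g" if "g \<in> G" for g
      using that G(2) assms(3) by (auto simp: C0_def)
    then show ?thesis
      using G pointwise_bounded_finite equicontinuous_finite equivanishing_finite by blast
  qed
  then show "pointwise_bounded X F \<and> equicontinuous X F \<and> equivanishing X F"
    using pointwise_bounded_if_uniform_net[of X 1] equicontinuous_if_uniform_nets
      equivanishing_if_uniform_nets zero_less_one by metis
next
  assume "pointwise_bounded X F \<and> equicontinuous X F \<and> equivanishing X F"
  then show "\<forall>\<epsilon>>0. \<exists>G. finite G \<and> G \<subseteq> F \<and> uniform_net X \<epsilon> G F"
    by (metis finite_net_if_equicontinuous_equivanishing)
qed

end
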